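(* Let $\phi(z)=\xi z$, where $\xi\in\overline{\mathbb{D}}$, let $C_\phi$ be the composition operator $C_\phi f=f\circ\phi$ on $H^2(\mathbb{D})$, and let $0<q\le1$. Then the following statements are equivalent: (i) The set $\mathrm{Ber}_q(C_\phi)$ is convex. (ii) The set $\mathrm{Ber}_q(C_\phi)$ is a (possibly degenerate) line-segment. (iii) $\xi\in[-1,1]$.
   Context: $\mathbb{D}$ is the open unit disc in $\mathbb{C}$ and $\overline{\mathbb{D}}$ its closure. $H^2(\mathbb{D})$ is the Hardy space of analytic functions $\sum_{n\ge0}a_nz^n$ on $\mathbb{D}$ with $\sum|a_n|^2<\infty$ and inner product $\langle\sum a_nz^n,\sum b_nz^n\rangle=\sum a_n\overline{b_n}$. Its reproducing kernel at $w\in\mathbb{D}$ is $k_w(z)=\frac{1}{1-\overline{w}z}$, and $\hat{k}_w=k_w/\|k_w\|$. For a bounded linear operator $T$ on $H^2(\mathbb{D})$ and $0<q\le1$, the $q$-Berezin range is $\mathrm{Ber}_q(T)=\{\langle T\hat{k}_{w_1},\hat{k}_{w_2}\rangle: w_1,w_2\in\mathbb{D},\ \langle\hat{k}_{w_1},\hat{k}_{w_2}\rangle=q\}$. A line-segment is a bounded nonempty convex subset of a straight line in $\mathbb{C}$, not required to contain its endpoints; a single point is a degenerate line-segment. *)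

theory Defs
  imports "HOL-Complex_Analysis.Complex_Analysis"
begin

text \<open>Elements of \<open>H\<^sup>2\<close> of the unit disc are represented by functions on all of \<open>\<complex>\<close>
  whose values outside the disc are irrelevant: everything below depends only on the
  restriction to \<^term>\<open>ball (0::complex) 1\<close>.\<close>

definition taylor_coeff :: "(complex \<Rightarrow> complex) \<Rightarrow> nat \<Rightarrow> complex" where
  "taylor_coeff f n = (deriv ^^ n) f 0 / fact n"

definition hardy_space :: "(complex \<Rightarrow> complex) set" where
  "hardy_space = {f. f holomorphic_on ball 0 1 \<and> summable (\<lambda>n. (norm (taylor_coeff f n))\<^sup>2)}"

definition hardy_inner :: "(complex \<Rightarrow> complex) \<Rightarrow> (complex \<Rightarrow> complex) \<Rightarrow> complex" where
  "hardy_inner f g = (\<Sum>n. taylor_coeff f n * cnj (taylor_coeff g n))"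

definition hardy_norm :: "(complex \<Rightarrow> complex) \<Rightarrow> real" where
  "hardy_norm f = sqrt (Re (hardy_inner f f))"

definition hardy_bounded_operator :: "((complex \<Rightarrow> complex) \<Rightarrow> complex \<Rightarrow> complex) \<Rightarrow> bool" where
  "hardy_bounded_operator T \<longleftrightarrow>
     (\<forall>f\<in>hardy_space. T f \<in> hardy_space) \<and>
     (\<forall>f\<in>hardy_space. \<forall>g\<in>hardy_space. \<forall>z\<in>ball 0 1. T (\<lambda>u. f u + g u) z = T f z + T g z) \<and>
     (\<forall>c. \<forall>f\<in>hardy_space. \<forall>z\<in>ball 0 1. T (\<lambda>u. c * f u) z = c * T f z) \<and>
     (\<exists>B. \<forall>f\<in>hardy_space. hardy_norm (T f) \<le> B * hardy_norm f)"

definition hardy_kernel :: "complex \<Rightarrow> complex \<Rightarrow> complex" where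
  "hardy_kernel w z = 1 / (1 - cnj w * z)"

definition normalized_kernel :: "complex \<Rightarrow> complex \<Rightarrow> complex" where
  "normalized_kernel w z = hardy_kernel w z / of_real (hardy_norm (hardy_kernel w))"

text \<open>Meant for operators \<open>T\<close> satisfying \<^const>\<open>hardy_bounded_operator\<close>; the composition
  operators considered here do, see \<open>hardy_bounded_operator_dilation\<close> below.\<close>

definition q_berezin_range ::
    "real \<Rightarrow> ((complex \<Rightarrow> complex) \<Rightarrow> complex \<Rightarrow> complex) \<Rightarrow> complex set" where
  "q_berezin_range q T =
     {hardy_inner (T (normalized_kernel w1)) (normalized_kernel w2) | w1 w2.
        w1 \<in> ball 0 1 \<and> w2 \<in> ball 0 1 \<and>
        hardy_inner (normalized_kernel w1) (normalized_kernel w2) = of_real q}"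

definition composition_operator ::
    "(complex \<Rightarrow> complex) \<Rightarrow> (complex \<Rightarrow> complex) \<Rightarrow> complex \<Rightarrow> complex" where
  "composition_operator \<phi> f = f \<circ> \<phi>"

text \<open>\<^const>\<open>collinear\<close> says that the set lies in a straight line.  End points need not
  belong to the set, and single points are allowed.\<close>

definition line_segment :: "complex set \<Rightarrow> bool" where
  "line_segment S \<longleftrightarrow> S \<noteq> {} \<and> bounded S \<and> convex S \<and> collinear S"

lemma taylor_coeff_kernel:
  assumes "w \<in> ball 0 1"
  shows "taylor_coeff (hardy_kernel w) n = cnj w ^ n"
proof -
  define F where "F = Abs_fps (\<lambda>n. cnj w ^ n)"
  have inv: "inverse (1 - fps_const (cnj w) * fps_X) = F"
  proof (rule fps_inverse_unique)
    show "(1 - fps_const (cnj w) * fps_X) * F = 1"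
    proof (rule fps_ext)
      fix n show "fps_nth ((1 - fps_const (cnj w) * fps_X) * F) n = fps_nth 1 n"
        by (cases n) (simp_all add: F_def left_diff_distrib mult.assoc)
    qed
  qed
  have "(\<lambda>z. inverse (1 - cnj w * z)) has_fps_expansion
          inverse (1 - fps_const (cnj w) * fps_X)"
    by (intro fps_expansion_intros) simp_all
  then have "hardy_kernel w has_fps_expansion F"
    unfolding inv hardy_kernel_def by (simp add: inverse_eq_divide)
  from fps_nth_fps_expansion[OF this, of n] show ?thesis
    by (simp add: taylor_coeff_def F_def)
qed

lemma kernel_in_hardy_space:
  assumes w: "w \<in> ball 0 1"
  shows "hardy_kernel w \<in> hardy_space"
proof -
  have "1 - cnj w * z \<noteq> 0" if "z \<in> ball 0 1" for z
  proof
    assume "1 - cnj w * z = 0"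
    then have "norm w * norm z = 1"
      by (metis complex_mod_cnj eq_iff_diff_eq_0 norm_mult norm_one)
    moreover have "norm w * norm z < 1 * 1"
      using w that by (intro mult_strict_mono') auto
    ultimately show False by simp
  qed
  then have "hardy_kernel w holomorphic_on ball 0 1"
    unfolding hardy_kernel_def by (intro holomorphic_intros) auto
  moreover have "summable (\<lambda>n. ((norm w)\<^sup>2) ^ n)"
    using w by (intro summable_geometric) (simp add: power_less_one_iff)
  ultimately show ?thesis
    using w unfolding hardy_space_def
    by (simp add: taylor_coeff_kernel norm_power mult.commute flip: power_mult)
qed

lemma kernel_reproducing:
  assumes f: "f \<in> hardy_space" and w: "w \<in> ball 0 1"
  shows "hardy_inner f (hardy_kernel w) = f w"
proof -
  have "(\<lambda>n. (deriv ^^ n) f 0 / fact n * (w - 0) ^ n) sums f w"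
    using f w by (intro holomorphic_power_series[of _ 0 1]) (auto simp: hardy_space_def)
  then show ?thesis
    using w by (simp add: hardy_inner_def taylor_coeff_kernel sums_iff) (simp add: taylor_coeff_def)
qed

lemma hardy_norm_eq:
  assumes "f \<in> hardy_space"
  shows "hardy_norm f = sqrt (\<Sum>n. (norm (taylor_coeff f n))\<^sup>2)"
proof -
  have "(\<lambda>n. (norm (taylor_coeff f n))\<^sup>2) sums (\<Sum>n. (norm (taylor_coeff f n))\<^sup>2)"
    using assms by (simp add: hardy_space_def summable_sums)
  then have "hardy_inner f f = of_real (\<Sum>n. (norm (taylor_coeff f n))\<^sup>2)"
    unfolding hardy_inner_def complex_norm_square[symmetric]
    by (metis sums_of_real sums_unique)
  then show ?thesis by (simp add: hardy_norm_def)
qed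

lemma hardy_bounded_operator_dilation:
  assumes xi: "\<xi> \<in> cball 0 1"
  shows "hardy_bounded_operator (composition_operator (\<lambda>z. \<xi> * z))"
proof -
  have maps: "\<xi> * z \<in> ball 0 1" if "z \<in> ball 0 1" for z
  proof -
    have "norm \<xi> * norm z \<le> 1 * norm z" using xi by (intro mult_right_mono) auto
    then show ?thesis using that by (simp add: norm_mult)
  qed
  let ?C = "composition_operator (\<lambda>z. \<xi> * z)"
  have coeff: "taylor_coeff (?C f) n = \<xi> ^ n * taylor_coeff f n" if "f \<in> hardy_space" for f n
    using higher_deriv_compose_linear[of f "ball 0 1" "ball 0 1" 0 \<xi> n] that maps
    by (simp add: taylor_coeff_def composition_operator_def hardy_space_def o_def)
  have le: "(norm (taylor_coeff (?C f) n))\<^sup>2 \<le> (norm (taylor_coeff f n))\<^sup>2"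
    if "f \<in> hardy_space" for f n
  proof -
    have "norm \<xi> ^ n * norm (taylor_coeff f n) \<le> 1 * norm (taylor_coeff f n)"
      using xi by (intro mult_right_mono) (auto intro: power_le_one)
    then show ?thesis
      by (simp add: coeff[OF that] norm_mult norm_power power_mono)
  qed
  have closed: "?C f \<in> hardy_space" if f: "f \<in> hardy_space" for f
  proof -
    have "f holomorphic_on ball 0 1" and sm: "summable (\<lambda>n. (norm (taylor_coeff f n))\<^sup>2)"
      using f by (auto simp: hardy_space_def)
    moreover have "(\<lambda>z. \<xi> * z) holomorphic_on ball 0 1"
      by (intro holomorphic_intros)
    ultimately have "(f \<circ> (\<lambda>z. \<xi> * z)) holomorphic_on ball 0 1"
      using maps by (metis holomorphic_on_compose_gen image_subsetI)
    moreover have "summable (\<lambda>n. (norm (taylor_coeff (?C f) n))\<^sup>2)"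
      using le[OF f] by (intro summable_comparison_test'[OF sm, of 0]) simp
    ultimately show ?thesis by (simp add: hardy_space_def composition_operator_def)
  qed
  have "hardy_norm (?C f) \<le> 1 * hardy_norm f" if f: "f \<in> hardy_space" for f
  proof -
    have "(\<Sum>n. (norm (taylor_coeff (?C f) n))\<^sup>2) \<le> (\<Sum>n. (norm (taylor_coeff f n))\<^sup>2)"
      using f closed[OF f] by (intro suminf_le le) (simp_all add: hardy_space_def)
    then show ?thesis
      using f closed[OF f] by (simp add: hardy_norm_eq)
  qed
  then have "\<exists>B. \<forall>f\<in>hardy_space. hardy_norm (?C f) \<le> B * hardy_norm f" by blast
  with closed show ?thesis
    by (simp add: hardy_bounded_operator_def composition_operator_def)
qed

end

theory Submission
  imports Defs
begin

text \<open>The constraint \<open>\<langle>k\<^sub>1, k\<^sub>2\<rangle> = q\<close> on normalized kernels at \<open>w\<^sub>1, w\<^sub>2\<close> forces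
  \<open>s = cnj w\<^sub>1 * w\<^sub>2\<close> to be real, and exactly the \<open>s \<in> (-1, 1)\<close> with \<open>q (1 - s) \<le> 1 - \<bar>s\<bar>\<close>,
  which form an interval, arise. Hence the range is the curve
  \<open>s \<mapsto> q (1 - s) / (1 - \<xi> s)\<close> over an interval containing \<open>[0, 1)\<close>. For real \<open>\<xi>\<close> it is a
  bounded interval in the real line; for nonreal \<open>\<xi>\<close> it lies on a circle, which contains no
  midpoint of two distinct points of it.\<close>

section \<open>Inner products of normalized kernels\<close>

lemma taylor_coeff_divide:
  assumes "f holomorphic_on ball 0 1"
  shows "taylor_coeff (\<lambda>z. f z / c) n = taylor_coeff f n / c"
  using higher_deriv_cmult[OF assms, of 0 n "inverse c"]
  by (simp add: taylor_coeff_def divide_inverse mult_ac)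

text \<open>The coefficient series is geometric with ratio \<open>cnj a * w\<close>. The scalars are
  free because a dilated kernel keeps the normalizing constant of the original one.\<close>

lemma hardy_kernel_inner_divide:
  assumes "a \<in> ball 0 1" "w \<in> ball 0 1"
  shows "hardy_inner (\<lambda>z. hardy_kernel a z / c) (\<lambda>z. hardy_kernel w z / d)
    = hardy_kernel a w / (c * cnj d)"
proof -
  have hol: "hardy_kernel a holomorphic_on ball 0 1" "hardy_kernel w holomorphic_on ball 0 1"
    using assms[THEN kernel_in_hardy_space] by (auto simp: hardy_space_def)
  have "norm (cnj a * w) < 1"
    using assms mult_strict_mono'[of "norm a" 1 "norm w" 1] by (simp add: norm_mult)
  then have "(\<lambda>n. (cnj a * w) ^ n) sums (1 / (1 - cnj a * w))"
    by (rule geometric_sums)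
  then have "(\<lambda>n. (cnj a * w) ^ n / (c * cnj d)) sums (hardy_kernel a w / (c * cnj d))"
    unfolding hardy_kernel_def by (rule sums_divide)
  then show ?thesis
    using assms
    by (simp add: hardy_inner_def taylor_coeff_divide hol taylor_coeff_kernel
        power_mult_distrib sums_iff)
qed

lemma hardy_norm_kernel:
  assumes "w \<in> ball 0 1"
  shows "hardy_norm (hardy_kernel w) = 1 / sqrt (1 - (norm w)\<^sup>2)"
proof -
  have "hardy_inner (hardy_kernel w) (hardy_kernel w) = of_real (1 / (1 - (norm w)\<^sup>2))"
    using assms kernel_reproducing[OF kernel_in_hardy_space[OF assms] assms]
    by (simp add: hardy_kernel_def mult.commute flip: complex_norm_square)
  then show ?thesis
    by (simp add: hardy_norm_def real_sqrt_divide)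
qed

text \<open>Composing with the dilation turns the kernel at \<open>w1\<close> into the kernel at
  \<open>cnj \<xi> * w1\<close>, which is again in the disc; the case \<open>\<xi> = 1\<close>
  yields the constraint itself.\<close>

lemma dilation_inner_normalized_kernel:
  assumes w: "w1 \<in> ball 0 1" "w2 \<in> ball 0 1" and \<xi>: "\<xi> \<in> cball 0 1"
  shows "hardy_inner (composition_operator (\<lambda>z. \<xi> * z) (normalized_kernel w1)) (normalized_kernel w2)
    = of_real (sqrt ((1 - (norm w1)\<^sup>2) * (1 - (norm w2)\<^sup>2))) / (1 - \<xi> * (cnj w1 * w2))"
proof -
  have "norm \<xi> * norm w1 \<le> 1 * norm w1"
    using \<xi> by (intro mult_right_mono) auto
  then have a: "cnj \<xi> * w1 \<in> ball 0 1"
    using w by (simp add: norm_mult)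
  have "composition_operator (\<lambda>z. \<xi> * z) (normalized_kernel w1)
      = (\<lambda>z. hardy_kernel (cnj \<xi> * w1) z / of_real (hardy_norm (hardy_kernel w1)))"
    by (simp add: composition_operator_def normalized_kernel_def hardy_kernel_def fun_eq_iff mult_ac)
  moreover have "normalized_kernel w2
      = (\<lambda>z. hardy_kernel w2 z / of_real (hardy_norm (hardy_kernel w2)))"
    by (simp add: normalized_kernel_def fun_eq_iff)
  ultimately show ?thesis
    by (simp only: hardy_kernel_inner_divide[OF a w(2)])
      (simp add: hardy_norm_kernel[OF w(1)] hardy_norm_kernel[OF w(2)] hardy_kernel_def real_sqrt_mult mult_ac)
qed

lemma normalized_kernel_inner:
  assumes "w1 \<in> ball 0 1" "w2 \<in> ball 0 1"
  shows "hardy_inner (normalized_kernel w1) (normalized_kernel w2)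
    = of_real (sqrt ((1 - (norm w1)\<^sup>2) * (1 - (norm w2)\<^sup>2))) / (1 - cnj w1 * w2)"
  using dilation_inner_normalized_kernel[OF assms, of 1]
  by (simp add: composition_operator_def o_def)

section \<open>Admissible pairs and their real parameter\<close>

definition q_parameters :: "real \<Rightarrow> real set" where
  "q_parameters q = {s. \<bar>s\<bar> < 1 \<and> q * (1 - s) \<le> 1 - \<bar>s\<bar>}"

text \<open>The numerator \<open>A\<close> of the inner product is real, so the constraint makes
  \<open>1 - cnj w1 * w2 = A / q\<close> real. The bound on \<open>s\<close> then amounts to
  \<open>(norm w1 - norm w2)\<^sup>2 \<ge> 0\<close>.\<close>

lemma kernel_pair_parameter:
  assumes w: "w1 \<in> ball 0 1" "w2 \<in> ball 0 1" and q: "0 < q"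
    and eq: "hardy_inner (normalized_kernel w1) (normalized_kernel w2) = of_real q"
  obtains s where "s \<in> q_parameters q" "cnj w1 * w2 = of_real s"
    "sqrt ((1 - (norm w1)\<^sup>2) * (1 - (norm w2)\<^sup>2)) = q * (1 - s)"
proof -
  define A where "A = sqrt ((1 - (norm w1)\<^sup>2) * (1 - (norm w2)\<^sup>2))"
  have A: "of_real A / (1 - cnj w1 * w2) = of_real q"
    using eq normalized_kernel_inner[OF w] by (simp add: A_def)
  \<comment> \<open>A zero denominator would make the quotient 0, contrary to
    \<open>q > 0\<close>.\<close>
  then have ne: "1 - cnj w1 * w2 \<noteq> 0"
    using q by auto
  define s where "s = 1 - A / q"
  have s: "cnj w1 * w2 = of_real s"
    using A ne q by (simp add: s_def field_simps)
  have As: "A = q * (1 - s)"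
    using q by (simp add: s_def)
  have abs_s: "\<bar>s\<bar> = norm w1 * norm w2"
    using arg_cong[OF s, of norm] by (simp add: norm_mult)
  have s1: "\<bar>s\<bar> < 1"
    unfolding abs_s using w mult_strict_mono'[of "norm w1" 1 "norm w2" 1] by simp
  have "(1 - (norm w1)\<^sup>2) * (1 - (norm w2)\<^sup>2) \<le> (1 - \<bar>s\<bar>)\<^sup>2"
    unfolding abs_s using zero_le_power2[of "norm w1 - norm w2"]
    by (simp add: power2_eq_square algebra_simps)
  then have "A \<le> 1 - \<bar>s\<bar>"
    unfolding A_def using s1 by (intro real_le_lsqrt) auto
  then show ?thesis
    using that[of s] s s1 As by (simp add: q_parameters_def A_def)
qed

text \<open>Both points can be taken real, the second carrying the sign of \<open>s\<close>. The
  inequality for \<open>s\<close> gives \<open>2 * \<bar>s\<bar> \<le> t\<close>, which makes the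
  root \<open>v\<close> real.\<close>

lemma parameter_kernel_pair:
  assumes q: "0 < q" and s: "s \<in> q_parameters q"
  obtains w1 w2 where "w1 \<in> ball 0 1" "w2 \<in> ball 0 1" "cnj w1 * w2 = of_real s"
    "sqrt ((1 - (norm w1)\<^sup>2) * (1 - (norm w2)\<^sup>2)) = q * (1 - s)"
proof -
  have s1: "\<bar>s\<bar> < 1" and le: "q * (1 - s) \<le> 1 - \<bar>s\<bar>"
    using s by (auto simp: q_parameters_def)
  have pos: "0 < q * (1 - s)" using q s1 by simp
  define t where "t = 1 + s\<^sup>2 - (q * (1 - s))\<^sup>2"
  have "(q * (1 - s))\<^sup>2 \<le> (1 - \<bar>s\<bar>)\<^sup>2"
    using le pos by (intro power_mono) auto
  then have t2: "2 * \<bar>s\<bar> \<le> t"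
    by (simp add: t_def power2_eq_square algebra_simps)
  \<comment> \<open>The moduli \<open>a \<ge> b\<close> solve \<open>a\<^sup>2 + b\<^sup>2 = t\<close> and \<open>a b = \<bar>s\<bar>\<close>, so that
    \<open>(1 - a\<^sup>2) (1 - b\<^sup>2) = 1 - t + s\<^sup>2\<close>.\<close>
  define u v where "u = sqrt (t + 2 * \<bar>s\<bar>)" and "v = sqrt (t - 2 * \<bar>s\<bar>)"
  define a b where "a = (u + v) / 2" and "b = (u - v) / 2"
  have u2: "u\<^sup>2 = t + 2 * \<bar>s\<bar>" and v2: "v\<^sup>2 = t - 2 * \<bar>s\<bar>" and vu: "0 \<le> v" "v \<le> u"
    using t2 by (auto simp: u_def v_def)
  have "a * b = (u\<^sup>2 - v\<^sup>2) / 4" "a\<^sup>2 + b\<^sup>2 = (u\<^sup>2 + v\<^sup>2) / 2"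
    by (simp_all add: a_def b_def power2_eq_square field_simps)
  then have ab: "a * b = \<bar>s\<bar>" and sq: "a\<^sup>2 + b\<^sup>2 = t"
    by (simp_all add: u2 v2)
  have ba: "0 \<le> b" "b \<le> a"
    using vu by (simp_all add: a_def b_def)
  have "(1 - a\<^sup>2) * (1 - b\<^sup>2) = 1 - (a\<^sup>2 + b\<^sup>2) + (a * b)\<^sup>2"
    by (simp add: power2_eq_square algebra_simps)
  then have prod: "(1 - a\<^sup>2) * (1 - b\<^sup>2) = (q * (1 - s))\<^sup>2"
    by (simp add: ab sq t_def)
  \<comment> \<open>The smaller modulus is below 1 because \<open>a * b < 1\<close>; positivity of
    the product then forces the larger one below 1.\<close>
  have b1: "b < 1"
  proof (rule ccontr)
    assume "\<not> b < 1"
    then have "1 * 1 \<le> a * b" using ba by (intro mult_mono) auto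
    then show False using ab s1 by simp
  qed
  then have "0 < 1 - b\<^sup>2"
    using ba by (simp add: power_less_one_iff)
  moreover have "0 < (1 - a\<^sup>2) * (1 - b\<^sup>2)"
    unfolding prod using pos by (rule zero_less_power)
  ultimately have "0 < 1 - a\<^sup>2"
    by (simp add: zero_less_mult_iff)
  then have a1: "a < 1"
    using ba by (simp add: power_less_one_iff)
  \<comment> \<open>Unlike \<open>sgn\<close>, this sign is 1 at \<open>s = 0\<close>, so its
    modulus is always 1.\<close>
  define \<sigma> :: real where "\<sigma> = (if s < 0 then -1 else 1)"
  have \<sigma>: "\<bar>\<sigma>\<bar> = 1" "\<bar>s\<bar> * \<sigma> = s"
    by (auto simp: \<sigma>_def)
  show ?thesis
  proof (rule that[of "of_real a" "of_real (b * \<sigma>)"])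
    have "cnj (of_real a) * of_real (b * \<sigma>) = complex_of_real ((a * b) * \<sigma>)"
      by simp
    then show "cnj (of_real a) * of_real (b * \<sigma>) = complex_of_real s"
      by (simp only: ab \<sigma>)
    show "sqrt ((1 - (norm (complex_of_real a))\<^sup>2) * (1 - (norm (complex_of_real (b * \<sigma>)))\<^sup>2))
        = q * (1 - s)"
      using q s1 \<sigma> ba by (simp add: norm_mult abs_mult prod)
  qed (use ba a1 b1 \<sigma> in \<open>auto simp: norm_mult abs_mult\<close>)
qed

text \<open>The inner product sees the pair only through \<open>cnj w1 * w2\<close> and the square
  root, and the constraint expresses both by \<open>s\<close>.\<close>

lemma q_berezin_range_dilation:
  assumes \<xi>: "\<xi> \<in> cball 0 1" and q: "0 < q"
  shows "q_berezin_range q (composition_operator (\<lambda>z. \<xi> * z))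
    = (\<lambda>s. of_real (q * (1 - s)) / (1 - \<xi> * of_real s)) ` q_parameters q"
proof (intro equalityI subsetI)
  fix x assume "x \<in> q_berezin_range q (composition_operator (\<lambda>z. \<xi> * z))"
  then obtain w1 w2 where w: "w1 \<in> ball 0 1" "w2 \<in> ball 0 1"
    and eq: "hardy_inner (normalized_kernel w1) (normalized_kernel w2) = of_real q"
    and x: "x = hardy_inner (composition_operator (\<lambda>z. \<xi> * z) (normalized_kernel w1))
      (normalized_kernel w2)"
    by (auto simp: q_berezin_range_def)
  from w q eq obtain s where "s \<in> q_parameters q" "cnj w1 * w2 = of_real s"
    "sqrt ((1 - (norm w1)\<^sup>2) * (1 - (norm w2)\<^sup>2)) = q * (1 - s)"
    by (rule kernel_pair_parameter)
  then show "x \<in> (\<lambda>s. of_real (q * (1 - s)) / (1 - \<xi> * of_real s)) ` q_parameters q"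
    unfolding x dilation_inner_normalized_kernel[OF w \<xi>] by (intro image_eqI[of _ _ s]) simp_all
next
  fix x assume "x \<in> (\<lambda>s. of_real (q * (1 - s)) / (1 - \<xi> * of_real s)) ` q_parameters q"
  then obtain s where s: "s \<in> q_parameters q"
    and x: "x = of_real (q * (1 - s)) / (1 - \<xi> * of_real s)"
    by auto
  from q s obtain w1 w2 where w: "w1 \<in> ball 0 1" "w2 \<in> ball 0 1"
    and ws: "cnj w1 * w2 = of_real s"
      "sqrt ((1 - (norm w1)\<^sup>2) * (1 - (norm w2)\<^sup>2)) = q * (1 - s)"
    by (rule parameter_kernel_pair)
  have "1 - s \<noteq> 0" using s by (auto simp: q_parameters_def)
  then have "complex_of_real (q * (1 - s)) / (1 - of_real s) = of_real q"
    by (metis nonzero_mult_div_cancel_right of_real_1 of_real_diff of_real_divide)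
  then have "hardy_inner (normalized_kernel w1) (normalized_kernel w2) = of_real q"
    unfolding normalized_kernel_inner[OF w] ws .
  moreover have "x = hardy_inner (composition_operator (\<lambda>z. \<xi> * z) (normalized_kernel w1))
      (normalized_kernel w2)"
    unfolding x dilation_inner_normalized_kernel[OF w \<xi>] ws ..
  ultimately show "x \<in> q_berezin_range q (composition_operator (\<lambda>z. \<xi> * z))"
    using w by (auto simp: q_berezin_range_def)
qed

section \<open>The parameter interval and real \<open>\<xi>\<close>\<close>

lemma nonneg_in_q_parameters:
  assumes "q \<le> 1" "0 \<le> s" "s < 1"
  shows "s \<in> q_parameters q"
  using assms mult_right_mono[of q 1 "1 - s"] by (simp add: q_parameters_def)

text \<open>For negative \<open>s\<close> the condition is \<open>q * (1 - s) \<le> 1 + s\<close>;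
  the left side decreases and the right side increases, so it persists up to 0. On
  \<open>[0, 1)\<close> it follows from \<open>q \<le> 1\<close>.\<close>

lemma connected_q_parameters:
  assumes "0 < q" "q \<le> 1"
  shows "connected (q_parameters q)"
proof -
  have "x \<in> q_parameters q"
    if a: "a \<in> q_parameters q" and b: "b \<in> q_parameters q" and x: "a \<le> x" "x \<le> b" for a b x
  proof (cases "0 \<le> x")
    case True
    then show ?thesis
      using assms b x by (intro nonneg_in_q_parameters) (auto simp: q_parameters_def)
  next
    case False
    have "q * (1 - x) \<le> q * (1 - a)"
      using assms x by (intro mult_left_mono) auto
    then show ?thesis
      using a x False by (auto simp: q_parameters_def)
  qed
  then show ?thesis
    unfolding connected_iff_interval by blast
qed

text \<open>The chain \<open>q * (1 - s) \<le> 1 - \<bar>s\<bar> \<le> 1 - r * s\<close> bounds the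
  values by 1, and its last two terms keep the denominator positive. Continuity carries the interval
  to a connected, hence convex, set of reals.\<close>

lemma line_segment_range_real:
  fixes r q :: real
  assumes r: "\<bar>r\<bar> \<le> 1" and q: "0 < q" "q \<le> 1"
  shows "line_segment
    ((\<lambda>s. of_real (q * (1 - s)) / (1 - of_real r * of_real s)) ` q_parameters q)"
proof -
  define h where "h s = q * (1 - s) / (1 - r * s)" for s
  have rs: "1 - \<bar>s\<bar> \<le> 1 - r * s" for s
    using r mult_right_mono[of "\<bar>r\<bar>" 1 "\<bar>s\<bar>"] by (simp add: abs_mult[symmetric])
  have pos: "0 < 1 - r * s" if "s \<in> q_parameters q" for s
    using rs[of s] that by (auto simp: q_parameters_def)
  have "\<bar>h s\<bar> \<le> 1" if s: "s \<in> q_parameters q" for s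
  proof -
    have "0 \<le> q * (1 - s)" "q * (1 - s) \<le> 1 - r * s"
      using s q rs[of s] by (auto simp: q_parameters_def)
    then show ?thesis using pos[OF s] by (simp add: h_def)
  qed
  then have bdd: "bounded (h ` q_parameters q)"
    by (auto simp: bounded_iff)
  have "continuous_on (q_parameters q) h"
    unfolding h_def using pos by (intro continuous_intros) force
  then have conv: "convex (h ` q_parameters q)"
    using connected_continuous_image connected_q_parameters[OF q] convex_connected
    by (metis is_interval_connected_1 is_interval_convex_1)
  have img: "(\<lambda>s. of_real (q * (1 - s)) / (1 - of_real r * of_real s)) ` q_parameters q
    = complex_of_real ` h ` q_parameters q" (is "?S = _")
    by (auto simp: h_def image_image)
  have "collinear ?S"
    unfolding img collinear_def
    by (intro exI[of _ 1]) (auto simp: scaleR_conv_of_real simp flip: of_real_diff)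
  moreover have "?S \<noteq> {}"
    using nonneg_in_q_parameters[of q 0] q by auto
  moreover have "bounded ?S"
    unfolding img by (intro bounded_linear_image bdd bounded_linear_of_real)
  moreover have "convex ?S"
    unfolding img by (intro convex_linear_image conv bounded_linear.linear bounded_linear_of_real)
  ultimately show ?thesis
    by (simp add: line_segment_def)
qed

section \<open>Nonreal \<open>\<xi>\<close>\<close>

text \<open>Solving \<open>x (1 - \<xi> s) = q (1 - s)\<close> for \<open>s\<close> gives \<open>s = (x - q) / (\<xi> x - q)\<close>, and the
  equation expresses that this quotient is real. It describes a circle if \<open>Im \<xi> \<noteq> 0\<close>.\<close>

lemma dilation_curve_circle:
  fixes q s :: real
  assumes x: "x = of_real (q * (1 - s)) / (1 - \<xi> * of_real s)" and ne: "1 - \<xi> * of_real s \<noteq> 0"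
  shows "Im \<xi> * ((Re x)\<^sup>2 + (Im x)\<^sup>2) = q * (Im (\<xi> * x) - Im x)"
proof -
  have "x * (1 - \<xi> * of_real s) = of_real (q * (1 - s))"
    using x ne by simp
  then have "x - of_real q = of_real s * (\<xi> * x - of_real q)"
    by (simp add: algebra_simps)
  \<comment> \<open>Multiplying by the conjugate makes the right side real without a division, which
    also covers \<open>\<xi> * x = q\<close>.\<close>
  then have "(x - of_real q) * cnj (\<xi> * x - of_real q)
      = of_real s * ((\<xi> * x - of_real q) * cnj (\<xi> * x - of_real q))"
    by (simp only: mult.assoc)
  then have "Im ((x - of_real q) * cnj (\<xi> * x - of_real q)) = 0"
    by (simp only: complex_mult_cnj Im_complex_of_real flip: of_real_mult)
  then show ?thesis
    by (simp add: power2_eq_square algebra_simps)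
qed

text \<open>The circle equation is quadratic on the left and real-linear on the right. Comparing it
  at a midpoint with the average over the two ends leaves a multiple of their squared distance,
  which must vanish.\<close>

lemma not_convex_range_nonreal:
  assumes \<xi>: "\<xi> \<in> cball 0 1" and im: "Im \<xi> \<noteq> 0" and q: "0 < q" "q \<le> 1"
  shows "\<not> convex ((\<lambda>s. of_real (q * (1 - s)) / (1 - \<xi> * of_real s)) ` q_parameters q)"
    (is "\<not> convex (?g ` _)")
proof
  assume conv: "convex (?g ` q_parameters q)"
  have circle: "Im \<xi> * ((Re x)\<^sup>2 + (Im x)\<^sup>2) = q * (Im (\<xi> * x) - Im x)"
    if x: "x \<in> ?g ` q_parameters q" for x
  proof -
    obtain s where s: "s \<in> q_parameters q" "x = ?g s" using x by auto
    have "norm \<xi> * \<bar>s\<bar> \<le> 1 * \<bar>s\<bar>"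
      using \<xi> by (intro mult_right_mono) auto
    then have "norm (\<xi> * of_real s) < 1"
      using s by (auto simp: q_parameters_def norm_mult)
    then have "1 - \<xi> * of_real s \<noteq> 0" by auto
    with s(2) show ?thesis by (rule dilation_curve_circle)
  qed
  \<comment> \<open>These parameters are admissible for every \<open>q\<close>. The points are
    \<open>q\<close> and \<open>q / (2 - \<xi>)\<close>, which coincide only if
    \<open>\<xi> = 1\<close>.\<close>
  define x y where "x = ?g 0" and "y = ?g (1/2)"
  have xy: "x \<in> ?g ` q_parameters q" "y \<in> ?g ` q_parameters q"
    unfolding x_def y_def using q by (intro imageI nonneg_in_q_parameters; simp)+
  have "(1/2) *\<^sub>R x + (1/2) *\<^sub>R y \<in> ?g ` q_parameters q"
    using conv xy by (intro convexD) auto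
  from circle[OF this]
  have mid: "Im \<xi> * (((Re x + Re y) / 2)\<^sup>2 + ((Im x + Im y) / 2)\<^sup>2)
      = ((q * (Im (\<xi> * x) - Im x)) + (q * (Im (\<xi> * y) - Im y))) / 2"
    by (simp add: field_simps)
  have "Im \<xi> * ((Re x - Re y)\<^sup>2 + (Im x - Im y)\<^sup>2) = 0"
    using mid unfolding circle[OF xy(1), symmetric] circle[OF xy(2), symmetric]
    by (simp add: power2_eq_square field_simps)
  then have eq: "x = y"
    using im by (simp add: complex_eq_iff sum_power2_eq_zero_iff)
  have "2 - \<xi> \<noteq> 0" using im by (auto simp: complex_eq_iff)
  then have "y * (2 - \<xi>) = of_real q"
    by (simp add: y_def field_simps)
  then have "of_real q * (1 - \<xi>) = 0"
    using eq by (simp add: x_def algebra_simps)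
  then show False
    using q im by auto
qed

theorem theorem3p22:
  fixes \<xi> :: complex and q :: real
  assumes "\<xi> \<in> cball 0 1" and "0 < q" and "q \<le> 1"
  shows "(convex (q_berezin_range q (composition_operator (\<lambda>z. \<xi> * z)))
            \<longleftrightarrow> line_segment (q_berezin_range q (composition_operator (\<lambda>z. \<xi> * z))))
       \<and> (line_segment (q_berezin_range q (composition_operator (\<lambda>z. \<xi> * z)))
            \<longleftrightarrow> \<xi> \<in> complex_of_real ` {-1..1})"
proof -
  let ?S = "q_berezin_range q (composition_operator (\<lambda>z. \<xi> * z))"
  \<comment> \<open>The cycle from convexity to real \<open>\<xi>\<close>, to a segment, and back to
    convexity yields both equivalences.\<close>
  have "\<xi> \<in> complex_of_real ` {-1..1}" if "convex ?S"
  proof -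
    have "Im \<xi> = 0"
      using that not_convex_range_nonreal[OF assms(1) _ assms(2,3)]
      by (auto simp: q_berezin_range_dilation[OF assms(1,2)])
    then have "\<xi> = complex_of_real (Re \<xi>)"
      by (simp add: complex_eq_iff)
    moreover have "\<bar>Re \<xi>\<bar> \<le> 1"
      using assms(1) abs_Re_le_cmod[of \<xi>] by simp
    ultimately show ?thesis by (intro image_eqI[of _ _ "Re \<xi>"]) auto
  qed
  moreover have "line_segment ?S" if real: "\<xi> \<in> complex_of_real ` {-1..1}"
  proof -
    obtain r where r: "\<xi> = complex_of_real r" "r \<in> {-1..1}" using real ..
    then have "\<bar>r\<bar> \<le> 1" by auto
    from line_segment_range_real[OF this assms(2,3)]
    show ?thesis
      unfolding q_berezin_range_dilation[OF assms(1,2)] r(1)[symmetric] .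
  qed
  moreover have "line_segment ?S \<Longrightarrow> convex ?S"
    by (simp add: line_segment_def)
  ultimately show ?thesis by blast
qed

end
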